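(* For $n, m \in \mathbb{N}$, let $kr^c_{2-1}(n,m)$ be the number of partitions $\lambda_1 \le \lambda_2 \le \cdots \le \lambda_m$ of $n$ into $m$ parts with at most one occurrence of the part $1$, and difference at least three at distance three, such that if parts at distance two differ by at most one, then their sum, together with the intermediate part, is $\equiv 2 \pmod{3}$. Then $$\sum_{m,n \geq 0} kr^c_{2-1}(n,m)\, q^n x^m = \sum_{n_1, n_2, n_3 \geq 0} \frac{ q^{ ( 9n_3^2 + n_3 )/2 + 2n_2^2 + n_2 + n_1^2 + 6n_3n_2 + 3n_3n_1 + 2n_2n_1 }\, (-q; q^2)_{n_2}\, x^{3n_3 + 2n_2 + n_1} }{ (q; q)_{n_1} (q^2; q^2)_{n_2} (q^3; q^3)_{n_3} }.$$
   Context: $\mathbb{N}=\{0,1,2,\dots\}$. A partition of $n$ into $m$ parts is a non-decreasing sequence $\lambda_1 \le \cdots \le \lambda_m$ of positive integers with sum $n$ (the empty partition is the unique partition of $0$, with $m=0$; it satisfies all the conditions vacuously). "Difference at least $k$ at distance $d$" means $\lambda_{j+d}-\lambda_j \ge k$ for all $1 \le j \le m-d$. The condition on parts at distance two says: for each $1\le j \le m-2$, if $\lambda_{j+2}-\lambda_j \le 1$ then $\lambda_j+\lambda_{j+1}+\lambda_{j+2}$ is in the stated residue class modulo $3$. The $q$-Pochhammer symbol is $(a;q)_n = \prod_{j=1}^{n}(1-aq^{j-1})$, with $(a;q)_0=1$. The identity is one of formal power series in $q$ and $x$. The superscript $c$ and subscript $2-1$ in $kr^c_{2-1}$ are merely labels.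 *)

theory Defs
  imports
    "HOL-Analysis.Infinite_Sum"
    "HOL-Computational_Algebra.Formal_Power_Series"
begin

definition partition_into :: "nat \<Rightarrow> nat \<Rightarrow> nat list \<Rightarrow> bool" where
  "partition_into n m xs \<longleftrightarrow>
     sorted xs \<and> (\<forall>p \<in> set xs. 0 < p) \<and> sum_list xs = n \<and> length xs = m"

(* List positions start at 0. The truncated subtraction on nat is harmless for sorted lists. *)
definition diff_at_dist :: "nat \<Rightarrow> nat \<Rightarrow> nat list \<Rightarrow> bool" where
  "diff_at_dist k d xs \<longleftrightarrow> (\<forall>j. j + d < length xs \<longrightarrow> xs ! (j + d) - xs ! j \<ge> k)"

definition close_sum_cond :: "nat \<Rightarrow> nat list \<Rightarrow> bool" where
  "close_sum_cond r xs \<longleftrightarrow>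
     (\<forall>j. j + 2 < length xs \<longrightarrow> xs ! (j + 2) - xs ! j \<le> 1 \<longrightarrow>
        (xs ! j + xs ! (j + 1) + xs ! (j + 2)) mod 3 = r mod 3)"

definition krc21_partitions :: "nat \<Rightarrow> nat \<Rightarrow> nat list set" where
  "krc21_partitions n m =
     {xs. partition_into n m xs \<and> count_list xs 1 \<le> 1 \<and>
          diff_at_dist 3 3 xs \<and> close_sum_cond 2 xs}"

lemma finite_krc21_partitions: "finite (krc21_partitions n m)"
proof (rule finite_subset)
  show "krc21_partitions n m \<subseteq> {xs. set xs \<subseteq> {..n} \<and> length xs = m}"
    by (auto simp: krc21_partitions_def partition_into_def intro: member_le_sum_list)
  show "finite {xs. set xs \<subseteq> {..n} \<and> length xs = m}"
    by (rule finite_lists_length_eq) simp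
qed

definition krc21 :: "nat \<Rightarrow> nat \<Rightarrow> nat" where
  "krc21 n m = card (krc21_partitions n m)"

definition q_pochhammer :: "'a::comm_ring_1 \<Rightarrow> 'a \<Rightarrow> nat \<Rightarrow> 'a" where
  "q_pochhammer a q n = (\<Prod>j=1..n. 1 - a * q ^ (j - 1))"

(* Series in x and q are elements of rat fps fps: the outer variable is x and the
   coefficients are series in q, so that fps_const embeds the series in q. *)
definition krc21_gf :: "rat fps fps" where
  "krc21_gf = Abs_fps (\<lambda>m. Abs_fps (\<lambda>n. of_nat (krc21 n m)))"

end

theory Submission
  imports Defs
begin

text \<open>
Each side is the first component of a solution of the same q-difference system in two unknown
series, and the system has only one solution with constant coefficient 1.

Call a partition valid if it satisfies the two difference conditions, and let \<open>V\<close>, \<open>B\<close> and \<open>D\<close> be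
the generating functions of all valid partitions, of those that do not begin with \<open>1, 1\<close>, and of
those that begin neither with \<open>1, 1\<close> nor with \<open>1, 2, 2\<close>. The series to be computed is \<open>B\<close>. If a
valid partition begins with \<open>1, 1\<close>, then all further parts are at least 3, and lowering them by 2
gives an arbitrary partition counted by \<open>B\<close>; if it begins with \<open>1, 2, 2\<close>, then all further parts
are at least 4, and lowering them by 3 gives again an arbitrary partition counted by \<open>B\<close>. A
partition counted by \<open>D\<close> either has no part 1, or it is a 1 followed by the parts of a partition
counted by \<open>D\<close>, each raised by 1. As raising all parts by \<open>k\<close> replaces \<open>x\<close> by \<open>x q^k\<close>, this says
\<open>V(x) = B(x) + x^2 q^2 B(x q^2)\<close>, \<open>B(x) = D(x) + x^3 q^5 B(x q^3)\<close> and
\<open>D(x) = V(x q) + x q D(x q)\<close>, and \<open>V\<close> can be eliminated (lemma \<open>gf_system\<close>).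

On the analytic side, let \<open>S(a, b, c)\<close> be the triple sum with the additional factor
\<open>q^(a n1 + b n2 + c n3)\<close> in each summand; then \<open>S(a, b, c)\<close> at \<open>x q\<close> is \<open>S(a + 1, b + 2, c + 3)\<close>.
Raising one of \<open>a\<close>, \<open>b\<close>, \<open>c\<close> by 1, 2, 3 respectively multiplies the summands by \<open>q^n1\<close>,
\<open>q^(2 n2)\<close> or \<open>q^(3 n3)\<close>, and the difference \<open>1 - q^n1\<close> (and so on) cancels the last factor of a
denominator; after a shift of that summation index there remain other sums \<open>S\<close>. These contiguous
relations show that \<open>B = S(0, 0, 0)\<close>, \<open>D = S(0, 0, 3)\<close> solve the system
(lemma \<open>triple_sum_system\<close>). For the coefficients of \<open>x^m\<close> the system is a recursion that can be
solved because \<open>1 - q^m\<close> is not zero for \<open>m > 0\<close> (lemma \<open>q_difference_system_unique\<close>).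

The topology on the series in \<open>x\<close> is the \<open>x\<close>-adic one, and only finitely many index triples
contribute to each power of \<open>x\<close>. Hence the claimed infinite sum is a statement about finite sums,
one for each power of \<open>x\<close>.
\<close>

unbundle fps_syntax

section \<open>Dilation and a q-difference system\<close>

definition qpow :: "nat \<Rightarrow> rat fps fps" where
  "qpow s = fps_const (fps_X ^ s)"

text \<open>
The substitution of \<open>x q^k\<close> for \<open>x\<close>.
\<close>
definition dilate :: "nat \<Rightarrow> rat fps fps \<Rightarrow> rat fps fps" where
  "dilate k f = Abs_fps (\<lambda>m. fps_X ^ (k * m) * f $ m)"

lemma qpow_add: "qpow (s + t) = qpow s * qpow t"
  by (simp add: qpow_def power_add)

lemma X_qpow_mult_nth:
  "(fps_X ^ l * qpow s * f) $ m = (if m < l then 0 else fps_X ^ s * f $ (m - l))"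
  by (simp add: qpow_def mult.assoc fps_X_power_mult_nth)

lemma dilate_nth: "dilate k f $ m = fps_X ^ (k * m) * f $ m"
  by (simp add: dilate_def)

lemma dilate_add: "dilate k (f + g) = dilate k f + dilate k g"
  by (simp add: dilate_def fps_eq_iff algebra_simps)

lemma dilate_dilate: "dilate k (dilate l f) = dilate (k + l) f"
  by (simp add: dilate_def fps_eq_iff algebra_simps power_add)

lemma dilate_monomial: "dilate k (fps_X ^ l * qpow s * f) = fps_X ^ l * qpow (s + k * l) * dilate k f"
proof -
  have "dilate k (fps_X ^ l * qpow s * f) $ m = (fps_X ^ l * qpow (s + k * l) * dilate k f) $ m" for m
  proof (cases "m < l")
    case False
    then have "m = l + (m - l)" by simp
    then have "k * m = k * l + k * (m - l)" by (metis distrib_left)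
    then have "(fps_X :: rat fps) ^ (k * m) = fps_X ^ (k * l) * fps_X ^ (k * (m - l))"
      by (metis power_add)
    then show ?thesis
      using False unfolding dilate_nth X_qpow_mult_nth by (simp add: power_add mult_ac)
  qed (simp add: dilate_nth X_qpow_mult_nth)
  then show ?thesis by (simp add: fps_eq_iff)
qed

text \<open>
The terms \<open>D\<close> and \<open>dilate 1 F\<close> on the right are the only ones without a positive power of \<open>x\<close>, so
that at \<open>x^m\<close> all the others are known by induction. Together the two equations determine
\<open>(1 - q^m) F $ m\<close>, hence \<open>F $ m\<close> for \<open>m > 0\<close>, but they leave \<open>F $ 0\<close> free.
\<close>
lemma q_difference_system_unique:
  fixes F G D E :: "rat fps fps"
  assumes F: "F = D + fps_X ^ 3 * qpow 5 * dilate 3 F"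
    and D: "D = dilate 1 F + fps_X ^ 2 * qpow 4 * dilate 3 F + fps_X ^ 1 * qpow 1 * dilate 1 D"
    and G: "G = E + fps_X ^ 3 * qpow 5 * dilate 3 G"
    and E: "E = dilate 1 G + fps_X ^ 2 * qpow 4 * dilate 3 G + fps_X ^ 1 * qpow 1 * dilate 1 E"
    and init: "F $ 0 = G $ 0"
  shows "F = G"
proof -
  have "F $ m = G $ m \<and> D $ m = E $ m" for m
  proof (induction m rule: less_induct)
    case (less m)
    let ?q = "fps_X :: rat fps"
    have lower: "(fps_X ^ l * qpow s * dilate k F) $ m = (fps_X ^ l * qpow s * dilate k G) $ m"
      "(fps_X ^ l * qpow s * dilate k D) $ m = (fps_X ^ l * qpow s * dilate k E) $ m"
      if "l > 0" for l s k
      using less.IH[of "m - l"] that by (auto simp: X_qpow_mult_nth dilate_def)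
    define r where "r = (fps_X ^ 3 * qpow 5 * dilate 3 F) $ m"
    define r' where "r' = (fps_X ^ 2 * qpow 4 * dilate 3 F) $ m + (fps_X ^ 1 * qpow 1 * dilate 1 D) $ m"
    have Fm: "F $ m = D $ m + r"
      by (subst F) (simp add: r_def)
    have Gm: "G $ m = E $ m + r"
      by (subst G) (simp add: r_def lower)
    have Dm: "D $ m = ?q ^ m * F $ m + r'"
      by (subst D) (simp only: fps_add_nth r'_def, simp add: dilate_def add_ac)
    have Em: "E $ m = ?q ^ m * G $ m + r'"
      by (subst E) (simp only: fps_add_nth r'_def lower zero_less_numeral zero_less_one,
          simp add: dilate_def add_ac)
    have "F $ m = G $ m"
    proof (cases "m = 0")
      case True
      then show ?thesis using init by simp
    next
      case False
      have FG: "F $ m - G $ m = D $ m - E $ m"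
        unfolding Fm Gm by simp
      have DE: "D $ m - E $ m = ?q ^ m * F $ m - ?q ^ m * G $ m"
        unfolding Dm Em by simp
      have "F $ m - G $ m = ?q ^ m * (F $ m - G $ m)"
        unfolding right_diff_distrib by (rule trans[OF FG DE])
      then have "(1 - ?q ^ m) * (F $ m - G $ m) = 0"
        by (simp add: left_diff_distrib)
      moreover have "(1 - ?q ^ m) $ 0 \<noteq> 0"
        using False by simp
      then have "1 - ?q ^ m \<noteq> 0"
        by (metis fps_zero_nth)
      ultimately show ?thesis by simp
    qed
    then show ?case using Fm Gm by simp
  qed
  then show ?thesis by (simp add: fps_eq_iff)
qed

section \<open>Decomposing the partitions by their smallest parts\<close>

definition gf :: "nat list set \<Rightarrow> rat fps fps" where
  "gf L = Abs_fps (\<lambda>m. Abs_fps (\<lambda>n. of_nat (card {xs \<in> L. length xs = m \<and> sum_list xs = n})))"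

definition pos :: "nat list \<Rightarrow> bool" where
  "pos xs \<longleftrightarrow> (\<forall>y\<in>set xs. 0 < y)"

lemma pos_simps [simp]: "pos []" "pos (y # ys) \<longleftrightarrow> 0 < y \<and> pos ys"
  by (auto simp: pos_def)

definition shift :: "nat list \<Rightarrow> nat \<Rightarrow> nat list \<Rightarrow> nat list" where
  "shift p k xs = p @ map (\<lambda>y. y + k) xs"

lemma finite_bounded_pos: "finite {xs. pos xs \<and> length xs = m \<and> sum_list xs = n}"
proof (rule finite_subset)
  show "{xs. pos xs \<and> length xs = m \<and> sum_list xs = n} \<subseteq> {xs. set xs \<subseteq> {..n} \<and> length xs = m}"
    by (auto intro: member_le_sum_list)
  show "finite {xs. set xs \<subseteq> {..n} \<and> length xs = m}"
    by (rule finite_lists_length_eq) simp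
qed

text \<open>
Positivity of the parts makes every coefficient count a finite set; for infinite sets the
cardinality would not be additive.
\<close>
lemma gf_disjoint_union:
  assumes "\<And>xs. xs \<in> K \<Longrightarrow> pos xs" "\<And>xs. xs \<in> L \<Longrightarrow> pos xs" "K \<inter> L = {}"
  shows "gf (K \<union> L) = gf K + gf L"
proof -
  have "card {xs \<in> K \<union> L. length xs = m \<and> sum_list xs = n} =
      card {xs \<in> K. length xs = m \<and> sum_list xs = n} + card {xs \<in> L. length xs = m \<and> sum_list xs = n}"
    for m n
  proof -
    have "{xs \<in> K \<union> L. length xs = m \<and> sum_list xs = n} =
       {xs \<in> K. length xs = m \<and> sum_list xs = n} \<union> {xs \<in> L. length xs = m \<and> sum_list xs = n}"
      by auto
    moreover have "finite {xs \<in> K. length xs = m \<and> sum_list xs = n}"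
      "finite {xs \<in> L. length xs = m \<and> sum_list xs = n}"
      by (rule finite_subset[OF _ finite_bounded_pos[of m n]], use assms in auto)+
    ultimately show ?thesis
      using assms(3) by (simp only:) (rule card_Un_disjoint, auto)
  qed
  then show ?thesis by (simp add: gf_def fps_eq_iff)
qed

lemma sum_list_shift: "sum_list (shift p k xs) = sum_list p + (sum_list xs + k * length xs)"
  by (induction xs) (auto simp: shift_def)

lemma inj_shift: "inj (shift p k)"
  by (rule injI) (auto simp: shift_def inj_map_eq_map inj_def)

text \<open>
Adding \<open>k\<close> to each of \<open>m\<close> parts adds \<open>k m\<close> to the sum, which is the effect of the dilation.
\<close>
lemma gf_shift: "gf (shift p k ` L) = fps_X ^ length p * qpow (sum_list p) * dilate k (gf L)"
proof -
  have "gf (shift p k ` L) $ m $ n =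
      (fps_X ^ length p * qpow (sum_list p) * dilate k (gf L)) $ m $ n" for m n
  proof -
    let ?S = "{xs \<in> L. length p + length xs = m \<and> sum_list p + (sum_list xs + k * length xs) = n}"
    (* The lists in L whose shifts have length m and sum n. *)
    have "{ys \<in> shift p k ` L. length ys = m \<and> sum_list ys = n} = shift p k ` ?S"
      by (auto simp: sum_list_shift) (auto simp: shift_def)
    then have lhs: "gf (shift p k ` L) $ m $ n = of_nat (card ?S)"
      by (simp add: gf_def card_image[OF inj_on_subset[OF inj_shift]])
    show ?thesis
    proof (cases "length p \<le> m \<and> sum_list p + k * (m - length p) \<le> n")
      case True
      then have "?S = {xs \<in> L. length xs = m - length p \<and>
          sum_list xs = n - sum_list p - k * (m - length p)}"
        by auto
      then show ?thesis
        using True unfolding lhs X_qpow_mult_nth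
        by (auto simp: dilate_def gf_def fps_X_power_mult_nth)
    next
      case False
      then have "?S = {}"
        by auto
      then have "card ?S = 0" by (simp only: card.empty)
      then show ?thesis
        using False unfolding lhs X_qpow_mult_nth
        by (auto simp: dilate_def gf_def fps_X_power_mult_nth)
    qed
  qed
  then show ?thesis by (simp add: fps_eq_iff)
qed

definition valid :: "nat list \<Rightarrow> bool" where
  "valid xs \<longleftrightarrow> sorted xs \<and> pos xs \<and> diff_at_dist 3 3 xs \<and> close_sum_cond 2 xs"

lemma list_cases4:
  obtains "xs = []" | a where "xs = [a]" | a b where "xs = [a, b]"
  | a b c where "xs = [a, b, c]" | a b c d ys where "xs = a # b # c # d # ys"
  by (metis list.exhaust)

lemma diff_at_dist_3_simps [simp]:
  "diff_at_dist k 3 []" "diff_at_dist k 3 [a]" "diff_at_dist k 3 [a, b]"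
  "diff_at_dist k 3 [a, b, c]"
  "diff_at_dist k 3 (a # b # c # d # ys) \<longleftrightarrow> k \<le> d - a \<and> diff_at_dist k 3 (b # c # d # ys)"
  by (auto simp: diff_at_dist_def nth_Cons numeral_3_eq_3 split: nat.splits)

lemma close_sum_cond_simps [simp]:
  "close_sum_cond r []" "close_sum_cond r [a]" "close_sum_cond r [a, b]"
  "close_sum_cond r (a # b # c # ys) \<longleftrightarrow>
     (c - a \<le> 1 \<longrightarrow> (a + b + c) mod 3 = r mod 3) \<and> close_sum_cond r (b # c # ys)"
  by (auto simp: close_sum_cond_def nth_Cons split: nat.splits)

text \<open>
The conditions concern differences of parts and sums of three parts modulo 3, and a shift adds
\<open>3 k\<close> to such a sum.
\<close>
lemma valid_map_add:
  assumes "pos xs"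
  shows "valid (map (\<lambda>y. y + k) xs) \<longleftrightarrow> valid xs"
proof -
  have "(a + k + (b + k) + (c + k)) mod 3 = (a + b + c) mod 3" for a b c :: nat
  proof -
    have "a + k + (b + k) + (c + k) = (a + b + c) + 3 * k" by simp
    then show ?thesis by (metis mod_mult_self2)
  qed
  then have "close_sum_cond 2 (map (\<lambda>y. y + k) xs) \<longleftrightarrow> close_sum_cond 2 xs"
    by (auto simp: close_sum_cond_def)
  moreover have "diff_at_dist 3 3 (map (\<lambda>y. y + k) xs) \<longleftrightarrow> diff_at_dist 3 3 xs"
    by (auto simp: diff_at_dist_def)
  moreover have "sorted (map (\<lambda>y. y + k) xs) \<longleftrightarrow> sorted xs"
    by (simp add: sorted_map)
  moreover have "pos (map (\<lambda>y. y + k) xs)"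
    using assms by (auto simp: pos_def)
  ultimately show ?thesis using assms by (simp add: valid_def)
qed

definition all_valid :: "nat list set" where "all_valid = {xs. valid xs}"
definition no_11 :: "nat list set" where "no_11 = {xs. valid xs \<and> take 2 xs \<noteq> [1, 1]}"
definition no_11_122 :: "nat list set" where
  "no_11_122 = {xs. valid xs \<and> take 2 xs \<noteq> [1, 1] \<and> take 3 xs \<noteq> [1, 2, 2]}"

text \<open>
The condition on the part 1 is brought into the form of a forbidden beginning.
\<close>
lemma sorted_count_list_one:
  assumes "sorted xs" "pos xs"
  shows "count_list xs 1 \<le> 1 \<longleftrightarrow> take 2 xs \<noteq> [1, 1]"
proof (cases xs rule: remdups_adj.cases)
  case (3 a b ys)
  have "1 \<notin> set ys" if "b \<noteq> 1"
  proof
    assume "1 \<in> set ys"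
    then have "b \<le> 1" "0 < b"
      using assms by (auto simp: 3)
    then show False using that by simp
  qed
  then show ?thesis using assms by (auto simp: 3 count_list_0_iff)
qed auto

lemma krc21_gf_eq_gf: "krc21_gf = gf no_11"
proof -
  have "krc21_partitions n m = {xs \<in> no_11. length xs = m \<and> sum_list xs = n}" for n m
    using sorted_count_list_one
    by (auto simp: krc21_partitions_def partition_into_def no_11_def valid_def pos_def)
  then show ?thesis by (simp add: krc21_gf_def gf_def krc21_def)
qed

text \<open>
Of the three sorted patterns \<open>a, a, a\<close> and \<open>a, a, a + 1\<close> and \<open>a, a + 1, a + 1\<close> with parts at
distance two that differ by at most one, only the last has a sum of residue 2.
\<close>
lemma close_sum_2_iff:
  fixes a b c :: nat
  assumes "a \<le> b" "b \<le> c"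
  shows "(c - a \<le> 1 \<longrightarrow> (a + b + c) mod 3 = 2) \<longleftrightarrow> a + 1 < c \<or> a < b"
proof -
  have "(a + a + a) mod 3 = 0" "(a + a + (a + 1)) mod 3 = 1" "(a + (a + 1) + (a + 1)) mod 3 = 2"
    by presburger+
  moreover have "a + 1 < c \<or> b = a \<and> c = a \<or> b = a \<and> c = a + 1 \<or> b = a + 1 \<and> c = a + 1"
    using assms by arith
  ultimately show ?thesis by auto
qed

text \<open>
Unlike the definition, these rules consist of linear inequalities between at most four consecutive
parts, so that validity of a list with a given beginning can be decided by linear arithmetic.
\<close>
lemma valid_simps [simp]:
  "valid []"
  "valid [a] \<longleftrightarrow> 0 < a"
  "valid [a, b] \<longleftrightarrow> 0 < a \<and> a \<le> b"
  "valid [a, b, c] \<longleftrightarrow> 0 < a \<and> a \<le> b \<and> b \<le> c \<and> (a + 1 < c \<or> a < b)"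
  "valid (a # b # c # d # ys) \<longleftrightarrow>
     0 < a \<and> a \<le> b \<and> b \<le> c \<and> (a + 1 < c \<or> a < b) \<and> a + 3 \<le> d \<and> valid (b # c # d # ys)"
proof -
  show "valid []" "valid [a] \<longleftrightarrow> 0 < a" "valid [a, b] \<longleftrightarrow> 0 < a \<and> a \<le> b"
    by (auto simp: valid_def)
  show "valid [a, b, c] \<longleftrightarrow> 0 < a \<and> a \<le> b \<and> b \<le> c \<and> (a + 1 < c \<or> a < b)"
    using close_sum_2_iff[of a b c] by (auto simp: valid_def)
  have "3 \<le> d - a \<longleftrightarrow> a + 3 \<le> d" by arith
  moreover have "valid (a # b # c # d # ys) \<longleftrightarrow> 0 < a \<and> a \<le> b \<and> 3 \<le> d - a \<and>
      (c - a \<le> 1 \<longrightarrow> (a + b + c) mod 3 = 2) \<and> valid (b # c # d # ys)"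
    by (simp only: valid_def sorted2 pos_simps diff_at_dist_3_simps close_sum_cond_simps) auto
  moreover have "b \<le> c" if "valid (b # c # d # ys)"
    using that by (simp add: valid_def)
  ultimately show "valid (a # b # c # d # ys) \<longleftrightarrow>
     0 < a \<and> a \<le> b \<and> b \<le> c \<and> (a + 1 < c \<or> a < b) \<and> a + 3 \<le> d \<and> valid (b # c # d # ys)"
    using close_sum_2_iff[of a b c] by blast
qed

lemma valid_imp_ge:
  assumes "valid (a # xs)" "y \<in> set xs"
  shows "a \<le> y"
  using assms by (auto simp: valid_def)

lemma unshift:
  assumes "\<And>y. y \<in> set ys \<Longrightarrow> k < y"
  obtains zs where "ys = map (\<lambda>y. y + k) zs" "pos zs"
proof
  show "ys = map (\<lambda>y. y + k) (map (\<lambda>y. y - k) ys)"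
    using assms by (auto simp: map_idI o_def less_imp_le)
  show "pos (map (\<lambda>y. y - k) ys)"
    using assms by (auto simp: pos_def)
qed

text \<open>
If \<open>xs\<close> begins with \<open>a, b\<close>, the difference condition for \<open>1, 1, a + 2, b + 2\<close> requires \<open>b \<ge> 2\<close>,
which forbids precisely the beginning \<open>1, 1\<close>. The other conditions that involve the prefix then
hold automatically. The beginning \<open>1, 2, 2\<close> of the next lemma leads to the same requirement, from
\<open>2, 2, a + 3, b + 3\<close>.
\<close>
lemma valid_prefix_11:
  assumes "pos xs"
  shows "valid (shift [1, 1] 2 xs) \<longleftrightarrow> xs \<in> no_11"
  using valid_map_add[OF assms, of 2] assms
  by (cases xs rule: list_cases4) (auto simp: no_11_def shift_def)

lemma valid_prefix_122:
  assumes "pos xs"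
  shows "valid (shift [1, 2, 2] 3 xs) \<longleftrightarrow> xs \<in> no_11"
  using valid_map_add[OF assms, of 3] assms
  by (cases xs rule: list_cases4) (auto simp: no_11_def shift_def)

text \<open>
A new part 1 must not be followed by \<open>1\<close> or \<open>2, 2\<close>, and the difference condition rules out
\<open>1, 2, 3, 3\<close>. The first cannot occur after the shift; the other two say that \<open>xs\<close> begins neither
with \<open>1, 1\<close> nor with \<open>1, 2, 2\<close>.
\<close>
lemma no_11_122_prefix_1:
  assumes "pos xs"
  shows "shift [1] 1 xs \<in> no_11_122 \<longleftrightarrow> xs \<in> no_11_122"
  using valid_map_add[OF assms, of 1] assms
  by (cases xs rule: list_cases4) (auto simp: no_11_122_def shift_def)

lemma valid_imp_pos: "valid xs \<Longrightarrow> pos xs"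
  by (simp add: valid_def)

lemma valid_tail_shift:
  assumes "valid (p @ ys)" "\<And>c zs. ys = c # zs \<Longrightarrow> k < c"
  obtains zs where "p @ ys = shift p k zs" "pos zs"
proof -
  have "k < y" if "y \<in> set ys" for y
    using assms that by (cases ys) (force simp: valid_def sorted_append)+
  then obtain zs where "ys = map (\<lambda>y. y + k) zs" "pos zs"
    using unshift by blast
  then show ?thesis using that by (simp add: shift_def)
qed

lemma all_valid_decomposition:
  "all_valid = no_11 \<union> shift [1, 1] 2 ` no_11"
  "no_11 \<inter> shift [1, 1] 2 ` no_11 = {}"
proof -
  show "no_11 \<inter> shift [1, 1] 2 ` no_11 = {}"
    by (auto simp: no_11_def shift_def)
  have "xs \<in> shift [1, 1] 2 ` no_11" if "valid xs" "xs \<notin> no_11" for xs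
  proof -
    have "xs = [1, 1] @ drop 2 xs"
      using that by (metis (mono_tags, lifting) no_11_def append_take_drop_id mem_Collect_eq)
    then obtain ys where xs: "xs = [1, 1] @ ys" ..
    have "2 < c" if "ys = c # zs" for c zs
      using \<open>valid xs\<close> that by (cases zs) (auto simp: xs)
    then obtain zs where "xs = shift [1, 1] 2 zs" "pos zs"
      using valid_tail_shift \<open>valid xs\<close> xs by metis
    then show ?thesis using valid_prefix_11 \<open>valid xs\<close> by blast
  qed
  moreover have "shift [1, 1] 2 xs \<in> all_valid" if "xs \<in> no_11" for xs
    using that valid_prefix_11 by (auto simp: all_valid_def no_11_def dest: valid_imp_pos)
  ultimately show "all_valid = no_11 \<union> shift [1, 1] 2 ` no_11"
    by (auto simp: all_valid_def no_11_def)
qed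

lemma no_11_decomposition:
  "no_11 = no_11_122 \<union> shift [1, 2, 2] 3 ` no_11"
  "no_11_122 \<inter> shift [1, 2, 2] 3 ` no_11 = {}"
proof -
  show "no_11_122 \<inter> shift [1, 2, 2] 3 ` no_11 = {}"
    by (auto simp: no_11_122_def shift_def)
  have "xs \<in> shift [1, 2, 2] 3 ` no_11" if "xs \<in> no_11" "xs \<notin> no_11_122" for xs
  proof -
    have v: "valid xs" and "take 3 xs = [1, 2, 2]"
      using that by (auto simp: no_11_def no_11_122_def)
    then have "xs = [1, 2, 2] @ drop 3 xs"
      by (metis append_take_drop_id)
    then obtain ys where xs: "xs = [1, 2, 2] @ ys" ..
    have "3 < c" if "ys = c # zs" for c zs
      using v that by (auto simp: xs)
    then obtain zs where "xs = shift [1, 2, 2] 3 zs" "pos zs"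
      using valid_tail_shift v xs by metis
    then show ?thesis using valid_prefix_122 v by blast
  qed
  moreover have "shift [1, 2, 2] 3 xs \<in> no_11" if "xs \<in> no_11" for xs
  proof -
    have "valid (shift [1, 2, 2] 3 xs)"
      using that valid_prefix_122 by (auto simp: no_11_def dest: valid_imp_pos)
    then show ?thesis by (simp add: no_11_def shift_def)
  qed
  moreover have "no_11_122 \<subseteq> no_11" by (auto simp: no_11_def no_11_122_def)
  ultimately show "no_11 = no_11_122 \<union> shift [1, 2, 2] 3 ` no_11"
    by blast
qed

lemma no_11_122_decomposition:
  "no_11_122 = shift [] 1 ` all_valid \<union> shift [1] 1 ` no_11_122"
  "shift [] 1 ` all_valid \<inter> shift [1] 1 ` no_11_122 = {}"
proof -
  have no1: "1 \<notin> set (shift [] 1 xs)" if "pos xs" for xs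
    using that by (auto simp: shift_def pos_def)
  show "shift [] 1 ` all_valid \<inter> shift [1] 1 ` no_11_122 = {}"
  proof -
    have "1 \<in> set (shift [1] 1 xs)" for xs by (simp add: shift_def)
    then show ?thesis using no1 by (fastforce simp: all_valid_def dest: valid_imp_pos)
  qed
  have "xs \<in> shift [] 1 ` all_valid \<union> shift [1] 1 ` no_11_122" if "xs \<in> no_11_122" for xs
  proof (cases "\<exists>ys. xs = [1] @ ys")
    case True
    then obtain ys where xs: "xs = [1] @ ys" ..
    have v: "valid xs" and "take 2 xs \<noteq> [1, 1]"
      using that by (auto simp: no_11_122_def)
    then have "1 < c" if "ys = c # zs" for c zs
      using that valid_imp_ge[of 1 ys c] by (auto simp: xs)
    then obtain zs where "xs = shift [1] 1 zs" "pos zs"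
      using valid_tail_shift v xs by metis
    then show ?thesis using no_11_122_prefix_1 \<open>xs \<in> no_11_122\<close> by blast
  next
    case False
    have v: "valid xs" using that by (simp add: no_11_122_def)
    have "1 < c" if "xs = c # zs" for c zs
      using False that valid_imp_pos[OF v] by (cases "c = 1") auto
    then obtain zs where "xs = shift [] 1 zs" "pos zs"
      using valid_tail_shift[of "[]" xs 1] v by auto
    then show ?thesis using v valid_map_add[of zs 1] by (auto simp: all_valid_def shift_def)
  qed
  moreover have "shift [1] 1 xs \<in> no_11_122" if "xs \<in> no_11_122" for xs
    using that no_11_122_prefix_1 by (auto simp: no_11_122_def dest: valid_imp_pos)
  moreover have "shift [] 1 xs \<in> no_11_122" if "xs \<in> all_valid" for xs
  proof -
    have "pos xs" "valid xs" using that valid_imp_pos by (auto simp: all_valid_def)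
    then have "valid (shift [] 1 xs)" using valid_map_add[of xs 1] by (simp add: shift_def)
    moreover have "take n (shift [] 1 xs) \<noteq> 1 # us" for n us
      using no1[OF \<open>pos xs\<close>] by (metis in_set_takeD list.set_intros(1))
    ultimately show ?thesis by (simp add: no_11_122_def)
  qed
  ultimately show "no_11_122 = shift [] 1 ` all_valid \<union> shift [1] 1 ` no_11_122"
    by blast
qed

text \<open>
The series of all valid partitions is eliminated by substituting its decomposition into the one
of the partitions that begin neither with \<open>1, 1\<close> nor with \<open>1, 2, 2\<close>.
\<close>
lemma gf_system:
  "gf no_11 = gf no_11_122 + fps_X ^ 3 * qpow 5 * dilate 3 (gf no_11)"
  "gf no_11_122 = dilate 1 (gf no_11) +
     fps_X ^ 2 * qpow 4 * dilate 3 (gf no_11) + fps_X ^ 1 * qpow 1 * dilate 1 (gf no_11_122)"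
proof -
  have pos: "pos xs" if "xs \<in> all_valid \<or> xs \<in> no_11 \<or> xs \<in> no_11_122" for xs
    using that valid_imp_pos by (auto simp: all_valid_def no_11_def no_11_122_def)
  have pos': "pos ys" if "ys \<in> shift p k ` L" "pos p" "L \<subseteq> all_valid \<or> L \<subseteq> no_11 \<or> L \<subseteq> no_11_122"
    for ys p k L
    using that pos by (fastforce simp: shift_def pos_def)
  have "gf no_11 = gf no_11_122 + gf (shift [1, 2, 2] 3 ` no_11)"
    by (subst no_11_decomposition(1), rule gf_disjoint_union)
      (use pos pos' no_11_decomposition(2) in auto)
  then show "gf no_11 = gf no_11_122 + fps_X ^ 3 * qpow 5 * dilate 3 (gf no_11)"
    by (simp add: gf_shift power3_eq_cube mult.assoc)
  have "gf all_valid = gf no_11 + gf (shift [1, 1] 2 ` no_11)"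
    by (subst all_valid_decomposition(1), rule gf_disjoint_union)
      (use pos pos' all_valid_decomposition(2) in auto)
  then have gfA: "gf all_valid = gf no_11 + fps_X ^ 2 * qpow 2 * dilate 2 (gf no_11)"
    by (simp add: gf_shift numeral_2_eq_2)
  have "gf no_11_122 = gf (shift [] 1 ` all_valid) + gf (shift [1] 1 ` no_11_122)"
    by (subst no_11_122_decomposition(1), rule gf_disjoint_union)
      (use pos pos' no_11_122_decomposition(2) in auto)
  also have "\<dots> = dilate 1 (gf all_valid) + fps_X ^ 1 * qpow 1 * dilate 1 (gf no_11_122)"
    by (simp add: gf_shift qpow_def)
  also have "dilate 1 (gf all_valid) = dilate 1 (gf no_11) + fps_X ^ 2 * qpow 4 * dilate 3 (gf no_11)"
    unfolding gfA dilate_add dilate_monomial dilate_dilate by (simp del: One_nat_def)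
  finally show "gf no_11_122 = dilate 1 (gf no_11) +
     fps_X ^ 2 * qpow 4 * dilate 3 (gf no_11) + fps_X ^ 1 * qpow 1 * dilate 1 (gf no_11_122)" .
qed

section \<open>Contiguous relations of the triple sum\<close>

text \<open>
The exponent of \<open>x\<close> in the summand with these indices.
\<close>
definition size3 :: "nat \<times> nat \<times> nat \<Rightarrow> nat" where
  "size3 = (\<lambda>(n1, n2, n3). 3 * n3 + 2 * n2 + n1)"

lemma finite_size3: "finite {p. size3 p = m}"
  by (rule finite_subset[of _ "{..m} \<times> {..m} \<times> {..m}"]) (auto simp: size3_def)

definition by_size :: "(nat \<times> nat \<times> nat \<Rightarrow> rat fps) \<Rightarrow> rat fps fps" where
  "by_size h = Abs_fps (\<lambda>m. \<Sum>p | size3 p = m. h p)"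

text \<open>
In the \<open>x\<close>-adic topology a net converges if each coefficient is eventually constant. The
coefficient of \<open>x^m\<close> in a partial sum is final as soon as the finitely many indices of size \<open>m\<close>
are included.
\<close>
lemma has_sum_by_size: "((\<lambda>p. fps_const (h p) * fps_X ^ size3 p) has_sum by_size h) UNIV"
  unfolding has_sum_def
proof (rule tendsto_fpsI)
  fix m
  have "sum (\<lambda>p. fps_const (h p) * fps_X ^ size3 p) P $ m = by_size h $ m"
    if "finite P" "{p. size3 p = m} \<subseteq> P" for P
  proof -
    have "sum (\<lambda>p. fps_const (h p) * fps_X ^ size3 p) P $ m = (\<Sum>p\<in>P. if size3 p = m then h p else 0)"
      by (auto simp: fps_sum_nth fps_X_power_nth intro!: sum.cong)
    also have "\<dots> = (\<Sum>p | size3 p = m. h p)"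
      using that by (simp add: sum.If_cases Int_absorb1)
    finally show ?thesis by (simp add: by_size_def)
  qed
  then show "eventually (\<lambda>P. sum (\<lambda>p. fps_const (h p) * fps_X ^ size3 p) P $ m = by_size h $ m)
      (finite_subsets_at_top UNIV)"
    unfolding eventually_finite_subsets_at_top
    by (intro exI[of _ "{p. size3 p = m}"]) (auto simp: finite_size3)
qed

lemma by_size_diff: "by_size h - by_size h' = by_size (\<lambda>p. h p - h' p)"
  by (simp add: by_size_def fps_eq_iff sum_subtractf)

lemma by_size_add: "by_size h + by_size h' = by_size (\<lambda>p. h p + h' p)"
  by (simp add: by_size_def fps_eq_iff sum.distrib)

lemma by_size_qpow_mult: "qpow s * by_size h = by_size (\<lambda>p. fps_X ^ s * h p)"
  by (simp add: by_size_def fps_eq_iff qpow_def sum_distrib_left)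

text \<open>
Typically \<open>\<sigma>\<close> increments one of the three indices, and \<open>h\<close> vanishes where that index is 0.
\<close>
lemma by_size_reindex:
  assumes "inj \<sigma>" "\<And>p. size3 (\<sigma> p) = size3 p + k" "\<And>p. p \<notin> range \<sigma> \<Longrightarrow> h p = 0"
  shows "by_size h = fps_X ^ k * by_size (\<lambda>p. h (\<sigma> p))"
proof -
  have "(\<Sum>p | size3 p = m. h p) = (if m < k then 0 else \<Sum>p | size3 p = m - k. h (\<sigma> p))" for m
  proof -
    have "(\<Sum>p | size3 p = m. h p) = (\<Sum>p \<in> \<sigma> ` {p. size3 p + k = m}. h p)"
    proof (rule sum.mono_neutral_right[OF finite_size3])
      show "\<forall>p \<in> {p. size3 p = m} - \<sigma> ` {p. size3 p + k = m}. h p = 0"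
      proof
        fix p assume p: "p \<in> {p. size3 p = m} - \<sigma> ` {p. size3 p + k = m}"
        have "p \<noteq> \<sigma> p'" for p'
          using p assms(2)[of p'] by auto
        then show "h p = 0" using assms(3) by blast
      qed
    qed (use assms(2) in auto)
    also have "\<dots> = (\<Sum>p | size3 p + k = m. h (\<sigma> p))"
      by (subst sum.reindex) (auto intro: inj_on_subset[OF assms(1)])
    also have "\<dots> = (if m < k then 0 else \<Sum>p | size3 p = m - k. h (\<sigma> p))"
      by (auto intro!: sum.cong)
    finally show ?thesis .
  qed
  then show ?thesis by (simp add: by_size_def fps_eq_iff fps_X_power_mult_nth)
qed

abbreviation poch :: "nat \<Rightarrow> nat \<Rightarrow> rat fps" where
  "poch k \<equiv> q_pochhammer (fps_X ^ k) (fps_X ^ k)"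

lemma q_pochhammer_Suc: "q_pochhammer a q (Suc n) = q_pochhammer a q n * (1 - a * q ^ n)"
  by (simp add: q_pochhammer_def)

lemma poch_nth_0: "k > 0 \<Longrightarrow> poch k n $ 0 = 1"
  by (induction n) (simp_all add: q_pochhammer_def)

lemma inverse_poch_Suc:
  assumes "k > 0"
  shows "inverse (poch k (Suc n)) * (1 - fps_X ^ (k * Suc n)) = inverse (poch k n)"
proof -
  define u where "u = (1 - fps_X ^ (k * Suc n) :: rat fps)"
  have "poch k (Suc n) = poch k n * u"
    by (simp add: q_pochhammer_Suc u_def power_add power_mult)
  then have "inverse (poch k (Suc n)) * u = inverse (poch k n) * (inverse u * u)"
    by (simp only: fps_inverse_mult mult.assoc)
  also have "inverse u * u = 1"
    using assms by (intro inverse_mult_eq_1) (simp add: u_def)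
  finally show ?thesis by (simp only: u_def mult_1_right)
qed

definition poch_quot :: "nat \<Rightarrow> nat \<Rightarrow> nat \<Rightarrow> rat fps" where
  "poch_quot n1 n2 n3 = q_pochhammer (- fps_X) (fps_X\<^sup>2) n2 *
     inverse (poch 1 n1) * inverse (poch 2 n2) * inverse (poch 3 n3)"

definition expo :: "nat \<Rightarrow> nat \<Rightarrow> nat \<Rightarrow> nat" where
  "expo n1 n2 n3 = (9 * n3\<^sup>2 + n3) div 2 + 2 * n2\<^sup>2 + n2 + n1\<^sup>2
     + 6 * n3 * n2 + 3 * n3 * n1 + 2 * n2 * n1"

text \<open>
Each factor on the left is the last factor of one Pochhammer symbol in the denominator; for the
second index the numerator contributes its own last factor.
\<close>
lemma poch_quot_Suc:
  "poch_quot (Suc n1) n2 n3 * (1 - fps_X ^ Suc n1) = poch_quot n1 n2 n3"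
  "poch_quot n1 (Suc n2) n3 * (1 - fps_X ^ (2 * Suc n2)) = (1 + fps_X ^ (2 * n2 + 1)) * poch_quot n1 n2 n3"
  "poch_quot n1 n2 (Suc n3) * (1 - fps_X ^ (3 * Suc n3)) = poch_quot n1 n2 n3"
proof -
  show "poch_quot (Suc n1) n2 n3 * (1 - fps_X ^ Suc n1) = poch_quot n1 n2 n3"
    by (subst (2) poch_quot_def, subst inverse_poch_Suc[symmetric]) (simp_all add: poch_quot_def mult_ac)
  have "q_pochhammer (- fps_X) (fps_X\<^sup>2) (Suc n2) =
      (1 + fps_X ^ (2 * n2 + 1)) * q_pochhammer (- fps_X :: rat fps) (fps_X\<^sup>2) n2"
    by (simp add: q_pochhammer_Suc mult_ac flip: power_mult)
  then show "poch_quot n1 (Suc n2) n3 * (1 - fps_X ^ (2 * Suc n2)) =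
      (1 + fps_X ^ (2 * n2 + 1)) * poch_quot n1 n2 n3"
    by (subst (2) poch_quot_def, subst (2) inverse_poch_Suc[symmetric]) (simp_all add: poch_quot_def mult_ac)
  show "poch_quot n1 n2 (Suc n3) * (1 - fps_X ^ (3 * Suc n3)) = poch_quot n1 n2 n3"
    by (subst (2) poch_quot_def, subst (3) inverse_poch_Suc[symmetric]) (simp_all add: poch_quot_def mult_ac)
qed

lemma expo_Suc:
  "expo (Suc n1) n2 n3 = expo n1 n2 n3 + 1 + 2 * n1 + 2 * n2 + 3 * n3"
  "expo n1 (Suc n2) n3 = expo n1 n2 n3 + 3 + 2 * n1 + 4 * n2 + 6 * n3"
  "expo n1 n2 (Suc n3) = expo n1 n2 n3 + 5 + 3 * n1 + 6 * n2 + 9 * n3"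
proof -
  have "9 * (Suc n3)\<^sup>2 + Suc n3 = (9 * n3\<^sup>2 + n3) + (9 * n3 + 5) * 2"
    by (simp add: power2_eq_square)
  then have "(9 * (Suc n3)\<^sup>2 + Suc n3) div 2 = (9 * n3\<^sup>2 + n3) div 2 + (9 * n3 + 5)"
    by (simp only:) simp
  then show "expo n1 n2 (Suc n3) = expo n1 n2 n3 + 5 + 3 * n1 + 6 * n2 + 9 * n3"
    by (simp only: expo_def) (simp add: algebra_simps)
qed (simp_all add: expo_def power2_eq_square)

text \<open>
The linear parameters \<open>a\<close>, \<open>b\<close>, \<open>c\<close> make the family closed under dilation and under index
shifts.
\<close>
definition summand :: "nat \<Rightarrow> nat \<Rightarrow> nat \<Rightarrow> nat \<times> nat \<times> nat \<Rightarrow> rat fps" where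
  "summand a b c = (\<lambda>(n1, n2, n3). fps_X ^ (expo n1 n2 n3 + a * n1 + b * n2 + c * n3) * poch_quot n1 n2 n3)"

definition triple_sum :: "nat \<Rightarrow> nat \<Rightarrow> nat \<Rightarrow> rat fps fps" where
  "triple_sum a b c = by_size (summand a b c)"

lemma dilate_triple_sum: "dilate k (triple_sum a b c) = triple_sum (a + k) (b + 2 * k) (c + 3 * k)"
proof -
  have "fps_X ^ (k * size3 p) * summand a b c p = summand (a + k) (b + 2 * k) (c + 3 * k) p" for p
    by (cases p) (simp add: summand_def size3_def algebra_simps flip: power_add)
  then have "fps_X ^ (k * m) * (\<Sum>p | size3 p = m. summand a b c p) =
      (\<Sum>p | size3 p = m. summand (a + k) (b + 2 * k) (c + 3 * k) p)" for m
    by (auto simp: sum_distrib_left intro!: sum.cong)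
  then show ?thesis by (simp add: triple_sum_def dilate_def by_size_def)
qed

text \<open>
The summands of the difference have the factor \<open>1 - q^n1\<close>, which removes the last factor of the
denominator. Incrementing \<open>n1\<close> changes the quadratic exponent by a linear form, which accounts for
the new parameters. The other two relations arise in the same way from \<open>n2\<close> and \<open>n3\<close>.
\<close>
lemma triple_sum_contiguous_1:
  "triple_sum a b c = triple_sum (a + 1) b c +
     fps_X ^ 1 * qpow (1 + a) * triple_sum (a + 2) (b + 2) (c + 3)"
proof -
  let ?h = "\<lambda>p. summand a b c p - summand (a + 1) b c p"
  let ?\<sigma> = "\<lambda>(n1, n2, n3). (Suc n1, n2 :: nat, n3 :: nat)"
  have "triple_sum a b c - triple_sum (a + 1) b c = by_size ?h"
    by (simp add: triple_sum_def by_size_diff)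
  also have "\<dots> = fps_X ^ 1 * by_size (\<lambda>p. ?h (?\<sigma> p))"
  proof (rule by_size_reindex)
    fix p assume "p \<notin> range ?\<sigma>"
    then show "?h p = 0"
      by (cases p; cases "fst p") (auto simp: summand_def image_iff)
  qed (auto simp: inj_def size3_def)
  also have "(\<lambda>p. ?h (?\<sigma> p)) = (\<lambda>p. fps_X ^ (1 + a) * summand (a + 2) (b + 2) (c + 3) p)"
  proof
    fix p :: "nat \<times> nat \<times> nat"
    obtain n1 n2 n3 where p: "p = (n1, n2, n3)" by (cases p)
    let ?e = "expo (Suc n1) n2 n3 + a * Suc n1 + b * n2 + c * n3"
    have "?h (?\<sigma> p) = fps_X ^ ?e * (poch_quot (Suc n1) n2 n3 * (1 - fps_X ^ Suc n1))"
      by (simp add: p summand_def algebra_simps power_add)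
    also have "?e = (1 + a) + (expo n1 n2 n3 + (a + 2) * n1 + (b + 2) * n2 + (c + 3) * n3)"
      by (simp add: expo_Suc algebra_simps)
    finally show "?h (?\<sigma> p) = fps_X ^ (1 + a) * summand (a + 2) (b + 2) (c + 3) p"
      unfolding poch_quot_Suc by (simp add: p summand_def power_add mult_ac)
  qed
  finally show ?thesis
    by (simp add: triple_sum_def by_size_qpow_mult algebra_simps)
qed

text \<open>
There are two terms on the right because the numerator contributes a factor
\<open>1 + q^(2 n2 + 1)\<close>.
\<close>
lemma triple_sum_contiguous_2:
  "triple_sum a b c = triple_sum a (b + 2) c +
     fps_X ^ 2 * qpow (3 + b) *
       (triple_sum (a + 2) (b + 4) (c + 6) + qpow 1 * triple_sum (a + 2) (b + 6) (c + 6))"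
proof -
  let ?h = "\<lambda>p. summand a b c p - summand a (b + 2) c p"
  let ?\<sigma> = "\<lambda>(n1, n2, n3). (n1 :: nat, Suc n2, n3 :: nat)"
  have "triple_sum a b c - triple_sum a (b + 2) c = by_size ?h"
    by (simp add: triple_sum_def by_size_diff)
  also have "\<dots> = fps_X ^ 2 * by_size (\<lambda>p. ?h (?\<sigma> p))"
  proof (rule by_size_reindex)
    fix p assume "p \<notin> range ?\<sigma>"
    then show "?h p = 0"
      by (cases p; cases "fst (snd p)") (auto simp: summand_def image_iff)
  qed (auto simp: inj_def size3_def)
  also have "(\<lambda>p. ?h (?\<sigma> p)) = (\<lambda>p. fps_X ^ (3 + b) *
      (summand (a + 2) (b + 4) (c + 6) p + fps_X ^ 1 * summand (a + 2) (b + 6) (c + 6) p))"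
  proof
    fix p :: "nat \<times> nat \<times> nat"
    obtain n1 n2 n3 where p: "p = (n1, n2, n3)" by (cases p)
    let ?e = "expo n1 (Suc n2) n3 + a * n1 + b * Suc n2 + c * n3"
    define f where "f = expo n1 n2 n3 + (a + 2) * n1 + (b + 4) * n2 + (c + 6) * n3"
    have summand_f: "summand (a + 2) (b + 4) (c + 6) p = fps_X ^ f * poch_quot n1 n2 n3"
      by (simp add: p summand_def f_def)
    have "?h (?\<sigma> p) = fps_X ^ ?e * (poch_quot n1 (Suc n2) n3 * (1 - fps_X ^ (2 * Suc n2)))"
      by (simp add: p summand_def algebra_simps power_add mult_2_right)
    also have "?e = (3 + b) + f"
      by (simp add: f_def expo_Suc algebra_simps)
    also have "poch_quot n1 (Suc n2) n3 * (1 - fps_X ^ (2 * Suc n2)) =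
        (1 + fps_X ^ (2 * n2 + 1)) * poch_quot n1 n2 n3"
      by (rule poch_quot_Suc)
    finally have *: "?h (?\<sigma> p) = fps_X ^ (3 + b) *
        (1 + fps_X ^ (2 * n2 + 1)) * summand (a + 2) (b + 4) (c + 6) p"
      unfolding summand_f by (simp only: power_add mult_ac)
    have "summand (a + 2) (b + 6) (c + 6) p = fps_X ^ (2 * n2) * summand (a + 2) (b + 4) (c + 6) p"
      by (simp add: p summand_def algebra_simps flip: power_add)
    then show "?h (?\<sigma> p) = fps_X ^ (3 + b) *
        (summand (a + 2) (b + 4) (c + 6) p + fps_X ^ 1 * summand (a + 2) (b + 6) (c + 6) p)"
      unfolding * by (simp add: power_add algebra_simps)
  qed
  finally show ?thesis
    by (simp add: triple_sum_def by_size_qpow_mult by_size_add algebra_simps)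
qed

lemma triple_sum_contiguous_3:
  "triple_sum a b c = triple_sum a b (c + 3) +
     fps_X ^ 3 * qpow (5 + c) * triple_sum (a + 3) (b + 6) (c + 9)"
proof -
  let ?h = "\<lambda>p. summand a b c p - summand a b (c + 3) p"
  let ?\<sigma> = "\<lambda>(n1, n2, n3). (n1 :: nat, n2 :: nat, Suc n3)"
  have "triple_sum a b c - triple_sum a b (c + 3) = by_size ?h"
    by (simp add: triple_sum_def by_size_diff)
  also have "\<dots> = fps_X ^ 3 * by_size (\<lambda>p. ?h (?\<sigma> p))"
  proof (rule by_size_reindex)
    fix p assume "p \<notin> range ?\<sigma>"
    then show "?h p = 0"
      by (cases p; cases "snd (snd p)") (auto simp: summand_def image_iff)
  qed (auto simp: inj_def size3_def)
  also have "(\<lambda>p. ?h (?\<sigma> p)) = (\<lambda>p. fps_X ^ (5 + c) * summand (a + 3) (b + 6) (c + 9) p)"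
  proof
    fix p :: "nat \<times> nat \<times> nat"
    obtain n1 n2 n3 where p: "p = (n1, n2, n3)" by (cases p)
    let ?e = "expo n1 n2 (Suc n3) + a * n1 + b * n2 + c * Suc n3"
    have "?h (?\<sigma> p) = fps_X ^ ?e * (poch_quot n1 n2 (Suc n3) * (1 - fps_X ^ (3 * Suc n3)))"
      by (simp add: p summand_def algebra_simps power_add)
    also have "?e = (5 + c) + (expo n1 n2 n3 + (a + 3) * n1 + (b + 6) * n2 + (c + 9) * n3)"
      by (simp add: expo_Suc algebra_simps)
    finally show "?h (?\<sigma> p) = fps_X ^ (5 + c) * summand (a + 3) (b + 6) (c + 9) p"
      unfolding poch_quot_Suc by (simp add: p summand_def power_add mult_ac)
  qed
  finally show ?thesis
    by (simp add: triple_sum_def by_size_qpow_mult algebra_simps)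
qed

text \<open>
The first equation is the third contiguous relation. The second one comes from passing from
\<open>S(0, 0, 3)\<close> to \<open>S(1, 0, 3)\<close> and then to \<open>S(1, 2, 3)\<close>; two of the three remainders recombine to
\<open>S(1, 2, 6)\<close> by the first contiguous relation, read backwards.
\<close>
lemma triple_sum_system:
  "triple_sum 0 0 0 = triple_sum 0 0 3 + fps_X ^ 3 * qpow 5 * dilate 3 (triple_sum 0 0 0)"
  "triple_sum 0 0 3 = dilate 1 (triple_sum 0 0 0) +
     fps_X ^ 2 * qpow 4 * dilate 3 (triple_sum 0 0 0) + fps_X ^ 1 * qpow 1 * dilate 1 (triple_sum 0 0 3)"
proof -
  show "triple_sum 0 0 0 = triple_sum 0 0 3 + fps_X ^ 3 * qpow 5 * dilate 3 (triple_sum 0 0 0)"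
  proof -
    have "dilate 3 (triple_sum 0 0 0) = triple_sum 3 6 9" by (simp add: dilate_triple_sum)
    moreover have "triple_sum 0 0 0 = triple_sum 0 0 3 + fps_X ^ 3 * qpow 5 * triple_sum 3 6 9"
      using triple_sum_contiguous_3[of 0 0 0] by simp
    ultimately show ?thesis by metis
  qed
  let ?x = "fps_X :: rat fps fps"
  have dilate: "dilate 1 (triple_sum 0 0 0) = triple_sum 1 2 3"
    "dilate 3 (triple_sum 0 0 0) = triple_sum 3 6 9"
    "dilate 1 (triple_sum 0 0 3) = triple_sum 1 2 6"
    by (simp_all add: dilate_triple_sum numeral_2_eq_2)
  have q: "qpow 1 * qpow 2 = qpow 3" "qpow 3 * qpow 1 = qpow 4"
    by (simp_all del: One_nat_def flip: qpow_add)
  have "triple_sum 0 0 3 = triple_sum 1 0 3 + ?x * qpow 1 * triple_sum 2 2 6"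
    using triple_sum_contiguous_1[of 0 0 3] by (simp add: numeral_2_eq_2)
  also have "triple_sum 1 0 3 = triple_sum 1 2 3 +
      ?x ^ 2 * qpow 3 * (triple_sum 3 4 9 + qpow 1 * triple_sum 3 6 9)"
    using triple_sum_contiguous_2[of 1 0 3] by (simp add: numeral_2_eq_2 numeral_3_eq_3)
  also have "\<dots> + ?x * qpow 1 * triple_sum 2 2 6 =
      triple_sum 1 2 3 + ?x ^ 2 * qpow 4 * triple_sum 3 6 9 +
      ?x * qpow 1 * (triple_sum 2 2 6 + ?x * qpow 2 * triple_sum 3 4 9)"
    unfolding q[symmetric] by (simp add: algebra_simps power2_eq_square)
  also have "triple_sum 2 2 6 + ?x * qpow 2 * triple_sum 3 4 9 = triple_sum 1 2 6"
    using triple_sum_contiguous_1[of 1 2 6] by (simp add: eval_nat_numeral)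
  finally show "triple_sum 0 0 3 = dilate 1 (triple_sum 0 0 0) +
      ?x ^ 2 * qpow 4 * dilate 3 (triple_sum 0 0 0) + ?x ^ 1 * qpow 1 * dilate 1 (triple_sum 0 0 3)"
    unfolding dilate power_one_right .
qed

section \<open>The identity\<close>

lemma gf_no_11_eq_triple_sum: "gf no_11 = triple_sum 0 0 0"
proof (rule q_difference_system_unique[OF gf_system triple_sum_system])
  have "{xs \<in> no_11. length xs = 0 \<and> sum_list xs = n} = (if n = 0 then {[]} else {})" for n
    by (auto simp: no_11_def)
  then have "gf no_11 $ 0 = 1"
    by (auto simp: gf_def fps_eq_iff)
  moreover have "{p. size3 p = 0} = {(0, 0, 0)}"
    by (auto simp: size3_def)
  then have "triple_sum 0 0 0 $ 0 = 1"
    by (simp add: triple_sum_def by_size_def summand_def expo_def poch_quot_def q_pochhammer_def)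
  ultimately show "gf no_11 $ 0 = triple_sum 0 0 0 $ 0" by simp
qed

theorem theorem18:
  fixes q :: "rat fps" and x :: "rat fps fps"
  defines "q \<equiv> fps_X" and "x \<equiv> fps_X"
  shows "((\<lambda>(n1, n2, n3).
            fps_const
              (q ^ ((9 * n3\<^sup>2 + n3) div 2 + 2 * n2\<^sup>2 + n2 + n1\<^sup>2
                    + 6 * n3 * n2 + 3 * n3 * n1 + 2 * n2 * n1)
               * q_pochhammer (- q) (q\<^sup>2) n2
               / (q_pochhammer q q n1 * q_pochhammer (q\<^sup>2) (q\<^sup>2) n2 * q_pochhammer (q ^ 3) (q ^ 3) n3))
            * x ^ (3 * n3 + 2 * n2 + n1))
          has_sum krc21_gf) (UNIV :: (nat \<times> nat \<times> nat) set)"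
proof -
  have "q ^ expo n1 n2 n3 * q_pochhammer (- q) (q\<^sup>2) n2 /
      (q_pochhammer q q n1 * q_pochhammer (q\<^sup>2) (q\<^sup>2) n2 * q_pochhammer (q ^ 3) (q ^ 3) n3) =
      summand 0 0 0 (n1, n2, n3)" for n1 n2 n3
  proof -
    have "(poch 1 n1 * poch 2 n2 * poch 3 n3) $ 0 \<noteq> 0"
      using poch_nth_0[of 1] poch_nth_0[of 2] poch_nth_0[of 3] by simp
    then show ?thesis
      unfolding q_def
      by (simp add: fps_divide_unit summand_def poch_quot_def fps_inverse_mult mult.assoc)
  qed
  note summand = this[unfolded expo_def]
  have "krc21_gf = by_size (summand 0 0 0)"
    by (simp add: krc21_gf_eq_gf gf_no_11_eq_triple_sum triple_sum_def)
  then show ?thesis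
    using has_sum_by_size[of "summand 0 0 0"]
    by (simp add: summand x_def size3_def case_prod_unfold)
qed

end
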